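(* Let $\Theta=\{\theta_1<\dots<\theta_K\}$ with $\theta_1>0$. For any $\mu\in\Delta(\Theta)$ with full support and any strongly redistributive welfare function $w$, the following two statements are true: (i) If $\sigma^\star_\mu$ is feasible, then it is the unique $(\mathrm{P}^\star_{w,\mu})$-optimal segmentation and it does not give any rent to the seller. (ii) If $\sigma^\star_\mu$ is not feasible, then the (unique) $(\mathrm{P}^\star_{w,\mu})$-optimal segmentation gives a rent to the seller.
   Context: Setting. $\Theta=\{\theta_1<\dots<\theta_K\}$ is a finite set of positive reals (buyer types) and $P=\Theta$ (prices). $\Delta(X)$ is the set of probability distributions on a finite set $X$. The market $\mu\in\Delta(\Theta)$ satisfies $\mu(\theta)>0$ for all $\theta\in\Theta$. Segmentations. $\Sigma(\mu)$ is the set of $\sigma\in\Delta(\Theta\times P)$ such that $\sum_{p\in P}\sigma(\theta,p)=\mu(\theta)$ for all $\theta\in\Theta$ and (obedience) for all $p,q\in P$, $p\sum_{\theta\ge p}\sigma(\theta,p)\ge q\sum_{\theta\ge q}\sigma(\theta,p)$. Let $\Omega=\{(\theta,p)\in\Theta\times P:\theta\ge p\}$ and $\Sigma^\star(\mu)=\{\sigma\in\Sigma(\mu):\operatorname{supp}(\sigma)\subseteq\Omega\}$. Strictly redistributive welfare functions. $\overline{\mathcal{R}}$ is the set of $w:\Theta\times P\to\mathbb{R}$ such that: $w(\theta,p)=0$ if $\theta<p$ and $w(\theta,p)\ge0$ if $\theta\ge p$; for each $k$, $p\mapsto w(\theta_k,p)$ is strictly decreasing on $\{\theta_1,\dots,\theta_k\}$;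 and for all $\theta,\theta'\in\Theta$ and $p,p'\in P$ with $\theta'>\theta\ge p'>p$, $w(\theta,p)-w(\theta,p')> w(\theta',p)-w(\theta',p')$. Strongly redistributive. $w\in\overline{\mathcal{R}}$ is strongly redistributive if for any $p,\theta_k,\theta_\ell\in\Theta$ with $p<\theta_k<\theta_\ell$, $$[w(\theta_k,p)-w(\theta_k,\theta_k)]-[w(\theta_{k+1},p)-w(\theta_{k+1},\theta_k)]>\frac{\theta_{k+1}}{\theta_{k+1}-\theta_k}\,[w(\theta_\ell,\theta_k)-w(\theta_\ell,\theta_\ell)].$$ Optimality. $\sigma$ is $(\mathrm{P}^\star_{w,\mu})$-optimal if it maximizes $\sum_{(\theta,p)\in\Theta\times P}w(\theta,p)\sigma(\theta,p)$ over $\sigma\in\Sigma^\star(\mu)$. Uniform price and rents. The uniform optimal price $p^\star_\mu$ is the smallest maximizer over $p\in P$ of $p\sum_{\theta\ge p}\mu(\theta)$. A segmentation $\sigma\in\Sigma^\star(\mu)$ gives a rent to the seller if $\sum_{p\in P}p\sum_{\theta\ge p}\sigma(\theta,p)>p^\star_\mu\sum_{\theta\ge p^\star_\mu}\mu(\theta)$. The distribution $\sigma^\star_\mu$. If $p^\star_\mu>\theta_1$, $\sigma^\star_\mu\in\Delta(\Theta\times P)$ is defined by: $\sigma^\star_\mu(\theta,\theta_1)=\mu(\theta)$ if $\theta<p^\star_\mu$; $\sigma^\star_\mu(p^\star_\mu,\theta_1)=\min\bigl\{\mu(p^\star_\mu),\ \frac{\theta_1}{p^\star_\mu-\theta_1}\sum_{\theta<p^\star_\mu}\mu(\theta)\bigr\}$;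 $\sigma^\star_\mu(p^\star_\mu,p^\star_\mu)=\mu(p^\star_\mu)-\sigma^\star_\mu(p^\star_\mu,\theta_1)$; $\sigma^\star_\mu(\theta,p^\star_\mu)=\mu(\theta)$ if $\theta>p^\star_\mu$; and $\sigma^\star_\mu(\theta,p)=0$ otherwise. If $p^\star_\mu=\theta_1$, $\sigma^\star_\mu(\theta,\theta_1)=\mu(\theta)$ for all $\theta$ and $\sigma^\star_\mu(\theta,p)=0$ for $p\ne\theta_1$. $\sigma^\star_\mu$ is called feasible if it satisfies obedience (equivalently, $\sigma^\star_\mu\in\Sigma^\star(\mu)$). *)

theory Defs
  imports "HOL-Probability.Probability"
begin

text \<open>
  Throughout, \<open>\<Theta>\<close> is a finite set of positive reals that serves both as the set of buyer types and
  as the set of prices. Elements of \<open>\<Delta>(X)\<close> are probability mass functions whose support is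
  contained in \<open>X\<close>; a segmentation is a probability mass function on pairs (type, price).
\<close>

definition revenue :: "real set \<Rightarrow> (real \<Rightarrow> real) \<Rightarrow> real \<Rightarrow> real" where
  "revenue \<Theta> f p = p * (\<Sum>t | t \<in> \<Theta> \<and> p \<le> t. f t)"

definition obedient :: "real set \<Rightarrow> (real \<times> real) pmf \<Rightarrow> bool" where
  "obedient \<Theta> \<sigma> \<longleftrightarrow>
     (\<forall>p\<in>\<Theta>. \<forall>q\<in>\<Theta>. revenue \<Theta> (\<lambda>t. pmf \<sigma> (t, p)) p \<ge> revenue \<Theta> (\<lambda>t. pmf \<sigma> (t, p)) q)"

definition segmentations :: "real set \<Rightarrow> real pmf \<Rightarrow> (real \<times> real) pmf set" where
  "segmentations \<Theta> \<mu> =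
     {\<sigma>. set_pmf \<sigma> \<subseteq> \<Theta> \<times> \<Theta> \<and> (\<forall>t\<in>\<Theta>. (\<Sum>p\<in>\<Theta>. pmf \<sigma> (t, p)) = pmf \<mu> t) \<and> obedient \<Theta> \<sigma>}"

definition trade_region :: "real set \<Rightarrow> (real \<times> real) set" where
  "trade_region \<Theta> = {(t, p) \<in> \<Theta> \<times> \<Theta>. t \<ge> p}"

definition trade_segmentations :: "real set \<Rightarrow> real pmf \<Rightarrow> (real \<times> real) pmf set" where
  "trade_segmentations \<Theta> \<mu> = {\<sigma> \<in> segmentations \<Theta> \<mu>. set_pmf \<sigma> \<subseteq> trade_region \<Theta>}"

definition strictly_redistributive :: "real set \<Rightarrow> (real \<Rightarrow> real \<Rightarrow> real) \<Rightarrow> bool" where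
  "strictly_redistributive \<Theta> w \<longleftrightarrow>
     (\<forall>t\<in>\<Theta>. \<forall>p\<in>\<Theta>. (t < p \<longrightarrow> w t p = 0) \<and> (t \<ge> p \<longrightarrow> w t p \<ge> 0)) \<and>
     (\<forall>t\<in>\<Theta>. strict_antimono_on {p \<in> \<Theta>. p \<le> t} (w t)) \<and>
     (\<forall>t\<in>\<Theta>. \<forall>t'\<in>\<Theta>. \<forall>p\<in>\<Theta>. \<forall>p'\<in>\<Theta>. t' > t \<and> t \<ge> p' \<and> p' > p \<longrightarrow>
        w t p - w t p' > w t' p - w t' p')"

text \<open>If \<open>t = \<theta>\<^sub>k\<close> is not the largest type, then \<open>next_type \<Theta> t\<close> is \<open>\<theta>\<^bsub>k+1\<^esub>\<close>.\<close>

definition next_type :: "real set \<Rightarrow> real \<Rightarrow> real" where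
  "next_type \<Theta> t = Min {t' \<in> \<Theta>. t < t'}"

definition strongly_redistributive :: "real set \<Rightarrow> (real \<Rightarrow> real \<Rightarrow> real) \<Rightarrow> bool" where
  "strongly_redistributive \<Theta> w \<longleftrightarrow>
     strictly_redistributive \<Theta> w \<and>
     (\<forall>p\<in>\<Theta>. \<forall>t\<in>\<Theta>. \<forall>u\<in>\<Theta>. p < t \<and> t < u \<longrightarrow>
        (let t' = next_type \<Theta> t in
          (w t p - w t t) - (w t' p - w t' t) > t' / (t' - t) * (w u t - w u u)))"

definition welfare :: "real set \<Rightarrow> (real \<Rightarrow> real \<Rightarrow> real) \<Rightarrow> (real \<times> real) pmf \<Rightarrow> real" where
  "welfare \<Theta> w \<sigma> = (\<Sum>(t, p) \<in> \<Theta> \<times> \<Theta>. w t p * pmf \<sigma> (t, p))"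

definition optimal ::
  "real set \<Rightarrow> (real \<Rightarrow> real \<Rightarrow> real) \<Rightarrow> real pmf \<Rightarrow> (real \<times> real) pmf \<Rightarrow> bool" where
  "optimal \<Theta> w \<mu> \<sigma> \<longleftrightarrow> is_arg_max (welfare \<Theta> w) (\<lambda>\<sigma>. \<sigma> \<in> trade_segmentations \<Theta> \<mu>) \<sigma>"

definition uniform_price :: "real set \<Rightarrow> real pmf \<Rightarrow> real" where
  "uniform_price \<Theta> \<mu> = Min {p. is_arg_max (revenue \<Theta> (pmf \<mu>)) (\<lambda>p. p \<in> \<Theta>) p}"

definition gives_rent :: "real set \<Rightarrow> real pmf \<Rightarrow> (real \<times> real) pmf \<Rightarrow> bool" where
  "gives_rent \<Theta> \<mu> \<sigma> \<longleftrightarrow>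
     (\<Sum>p\<in>\<Theta>. revenue \<Theta> (\<lambda>t. pmf \<sigma> (t, p)) p) > revenue \<Theta> (pmf \<mu>) (uniform_price \<Theta> \<mu>)"

text \<open>
  The density of \<open>\<sigma>\<^sup>\<star>\<^sub>\<mu>\<close>; \<open>Min \<Theta>\<close> is \<open>\<theta>\<^sub>1\<close>, and \<open>a\<close> is the mass of the pair
  \<open>(p\<^sup>\<star>\<^sub>\<mu>, \<theta>\<^sub>1)\<close> when \<open>p\<^sup>\<star>\<^sub>\<mu> > \<theta>\<^sub>1\<close>.
\<close>

definition sigma_star_density :: "real set \<Rightarrow> real pmf \<Rightarrow> real \<times> real \<Rightarrow> real" where
  "sigma_star_density \<Theta> \<mu> = (\<lambda>(t, p).
     let b = Min \<Theta>;
         r = uniform_price \<Theta> \<mu>;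
         a = min (pmf \<mu> r) (b / (r - b) * (\<Sum>t | t \<in> \<Theta> \<and> t < r. pmf \<mu> t))
     in if r = b then (if p = b then pmf \<mu> t else 0)
        else if p = b then (if t < r then pmf \<mu> t else if t = r then a else 0)
        else if p = r then (if t = r then pmf \<mu> r - a else if t > r then pmf \<mu> t else 0)
        else 0)"

definition sigma_star :: "real set \<Rightarrow> real pmf \<Rightarrow> (real \<times> real) pmf" where
  "sigma_star \<Theta> \<mu> = embed_pmf (sigma_star_density \<Theta> \<mu>)"

lemma uniform_price_is_arg_max:
  assumes "finite \<Theta>" "\<Theta> \<noteq> {}"
  shows "is_arg_max (revenue \<Theta> (pmf \<mu>)) (\<lambda>p. p \<in> \<Theta>) (uniform_price \<Theta> \<mu>)"
proof -
  let ?S = "{p. is_arg_max (revenue \<Theta> (pmf \<mu>)) (\<lambda>p. p \<in> \<Theta>) p}"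
  have "finite ?S"
    by (rule finite_subset[OF _ assms(1)]) (auto simp: is_arg_max_def)
  moreover have "?S \<noteq> {}"
  proof -
    have "Max (revenue \<Theta> (pmf \<mu>) ` \<Theta>) \<in> revenue \<Theta> (pmf \<mu>) ` \<Theta>"
      using assms by (intro Max_in) auto
    then obtain p where "p \<in> \<Theta>" "Max (revenue \<Theta> (pmf \<mu>) ` \<Theta>) = revenue \<Theta> (pmf \<mu>) p"
      by auto
    then have "p \<in> ?S"
      using Max_ge[of "revenue \<Theta> (pmf \<mu>) ` \<Theta>"] assms(1)
      by (auto simp: is_arg_max_linorder)
    then show ?thesis by blast
  qed
  ultimately have "Min ?S \<in> ?S" by (rule Min_in)
  then show ?thesis by (simp add: uniform_price_def)
qed

text \<open>The density is a genuine one, so \<open>embed_pmf\<close> is applied within its intended domain.\<close>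

lemma pmf_sigma_star:
  assumes fin: "finite \<Theta>" and pos: "\<forall>t\<in>\<Theta>. 0 < t" and supp: "set_pmf \<mu> = \<Theta>"
  shows "pmf (sigma_star \<Theta> \<mu>) = sigma_star_density \<Theta> \<mu>"
proof -
  let ?f = "sigma_star_density \<Theta> \<mu>"
  define b where "b = Min \<Theta>"
  define r where "r = uniform_price \<Theta> \<mu>"
  define a where "a = min (pmf \<mu> r) (b / (r - b) * (\<Sum>t | t \<in> \<Theta> \<and> t < r. pmf \<mu> t))"
  have ne: "\<Theta> \<noteq> {}" using supp set_pmf_not_empty by metis
  have b: "b \<in> \<Theta>" "\<And>t. t \<in> \<Theta> \<Longrightarrow> b \<le> t" using fin ne by (auto simp: b_def)
  have r: "r \<in> \<Theta>"
    using uniform_price_is_arg_max[OF fin ne, of \<mu>] by (simp add: r_def is_arg_max_def)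
  have f: "?f (t, p) =
     (if r = b then (if p = b then pmf \<mu> t else 0)
      else if p = b then (if t < r then pmf \<mu> t else if t = r then a else 0)
      else if p = r then (if t = r then pmf \<mu> r - a else if t > r then pmf \<mu> t else 0)
      else 0)" for t p
    unfolding sigma_star_density_def Let_def by (simp add: a_def b_def r_def)
  have a: "0 \<le> a" "a \<le> pmf \<mu> r"
  proof -
    have "0 \<le> b / (r - b)" using b r pos by (intro divide_nonneg_nonneg) (auto intro: less_imp_le)
    moreover have "0 \<le> (\<Sum>t | t \<in> \<Theta> \<and> t < r. pmf \<mu> t)" by (intro sum_nonneg) auto
    ultimately show "0 \<le> a" unfolding a_def by (intro min.boundedI mult_nonneg_nonneg) auto
    show "a \<le> pmf \<mu> r" by (simp add: a_def)
  qed
  have nonneg: "0 \<le> ?f x" for x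
    using a by (cases x) (auto simp: f)
  have zero: "?f x = 0" if "x \<notin> \<Theta> \<times> \<Theta>" for x
  proof (cases x)
    case (Pair t p)
    have "pmf \<mu> t = 0" if "t \<notin> \<Theta>" using that supp by (metis set_pmf_iff)
    then show ?thesis using that b r Pair by (auto simp: f)
  qed
  have marg: "(\<Sum>p\<in>\<Theta>. ?f (t, p)) = pmf \<mu> t" if "t \<in> \<Theta>" for t
  proof -
    have "(\<Sum>p\<in>\<Theta>. ?f (t, p)) = (\<Sum>p\<in>{b, r}. ?f (t, p))"
      by (rule sum.mono_neutral_right) (use fin b r in \<open>auto simp: f\<close>)
    also have "\<dots> = pmf \<mu> t" by (cases "r = b") (auto simp: f)
    finally show ?thesis .
  qed
  have "(\<Sum>x\<in>\<Theta> \<times> \<Theta>. ?f x) = (\<Sum>t\<in>\<Theta>. \<Sum>p\<in>\<Theta>. ?f (t, p))"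
    by (simp add: sum.cartesian_product)
  also have "\<dots> = (\<Sum>t\<in>\<Theta>. pmf \<mu> t)" by (rule sum.cong) (auto simp: marg)
  also have "\<dots> = 1" using fin supp by (intro sum_pmf_eq_1) auto
  finally have sum1: "(\<Sum>x\<in>\<Theta> \<times> \<Theta>. ?f x) = 1" .
  have "(\<integral>\<^sup>+x. ennreal (?f x) \<partial>count_space UNIV) = (\<Sum>x\<in>\<Theta> \<times> \<Theta>. ennreal (?f x))"
    by (rule nn_integral_count_space') (use fin zero in auto)
  also have "\<dots> = 1" using sum1 nonneg by (subst sum_ennreal) auto
  finally show ?thesis
    unfolding sigma_star_def using nonneg by (intro ext pmf_embed_pmf) auto
qed

end

theory Submission
  imports Defs
begin

text \<open>
  The rent is a sum over segments of the nonnegative losses from charging \<open>p\<^sup>\<star>\<^sub>\<mu>\<close> there instead of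
  the segment's own price, so it vanishes iff \<open>p\<^sup>\<star>\<^sub>\<mu>\<close> is optimal in every segment.

  In a \<open>w\<close>-optimal segmentation, let the segment with price \<open>t\<close> be nonempty and let \<open>p < t\<close>. Strong
  redistributivity makes it profitable to move some mass of type \<open>t\<close> from the segment \<open>t\<close> to the
  segment \<open>p\<close>, possibly in exchange for an equal mass of a higher type, if obedience of the segment \<open>t\<close>
  is restored by moving part of its highest type \<open>u\<close> to the segment \<open>u\<close>. Hence the segment \<open>p\<close>
  has no types above \<open>t\<close>, and one of its obedience constraints up to \<open>t\<close> binds. It follows
  that an optimal segmentation is the lexicographically largest feasible one (prices in increasing
  order, then types in increasing order); in particular it is unique. A feasible \<open>\<sigma>\<^sup>\<star>\<^sub>\<mu>\<close>
  is lexicographically largest, because the constraint \<open>p\<^sup>\<star>\<^sub>\<mu>\<close> binds in its lowest segment. Conversely,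
  an optimal segmentation without rent has that constraint binding in its lowest segment, which
  excludes all segments other than \<open>\<theta>\<^sub>1\<close> and \<open>p\<^sup>\<star>\<^sub>\<mu>\<close> and forces it to be \<open>\<sigma>\<^sup>\<star>\<^sub>\<mu>\<close>.
\<close>

text \<open>Here \<open>a\<close> is the value of a constraint and \<open>b\<close> its rate of
  change along a direction. A slack constraint survives small steps by continuity, a binding one
  because its rate is nonnegative.\<close>

lemma eventually_affine_nonneg:
  fixes a b :: real
  assumes "0 \<le> a" "a = 0 \<Longrightarrow> 0 \<le> b"
  shows "\<forall>\<^sub>F e in at_right 0. 0 \<le> a + e * b"
proof (cases "a = 0")
  case True
  then show ?thesis
    using assms(2) eventually_at_right_less[of "0::real"] by (auto elim!: eventually_mono)
next
  case False
  have "((\<lambda>e. a + e * b) \<longlongrightarrow> a + 0 * b) (at_right 0)" by (intro tendsto_intros)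
  then show ?thesis
    using order_tendstoD(1)[of "\<lambda>e. a + e * b" a "at_right 0" 0] False assms(1)
    by (auto elim!: eventually_mono)
qed

section \<open>Segmentations as points of a polytope\<close>

locale market =
  fixes \<Theta> :: "real set" and \<mu> :: "real pmf"
  assumes finite_types: "finite \<Theta>"
    and types_pos: "\<And>t. t \<in> \<Theta> \<Longrightarrow> 0 < t"
    and full_support: "set_pmf \<mu> = \<Theta>"
begin

text \<open>The loss in the segment \<open>p\<close> from charging \<open>q\<close> there. Counting
  the whole column as buying at \<open>p\<close> is right when \<open>s\<close> vanishes off the
  trade region.\<close>

definition slack :: "(real \<times> real \<Rightarrow> real) \<Rightarrow> real \<Rightarrow> real \<Rightarrow> real" where
  "slack s p q = (\<Sum>t\<in>\<Theta>. (p - (if q \<le> t then q else 0)) * s (t, p))"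

text \<open>Real functions replace probability mass functions so that directions can be added and
  compactness used. Only upward deviations are listed; \<open>slack_nonneg\<close> supplies the
  others.\<close>

definition feasible :: "(real \<times> real \<Rightarrow> real) \<Rightarrow> bool" where
  "feasible s \<longleftrightarrow> (\<forall>x. 0 \<le> s x) \<and> (\<forall>x. x \<notin> trade_region \<Theta> \<longrightarrow> s x = 0) \<and>
     (\<forall>t\<in>\<Theta>. (\<Sum>p\<in>\<Theta>. s (t, p)) = pmf \<mu> t) \<and> (\<forall>p\<in>\<Theta>. \<forall>q\<in>\<Theta>. p < q \<longrightarrow> 0 \<le> slack s p q)"

lemma types_nonempty: "\<Theta> \<noteq> {}"
  using full_support set_pmf_not_empty by metis

lemma pmf_type_pos: "t \<in> \<Theta> \<Longrightarrow> 0 < pmf \<mu> t"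
  using full_support by (metis pmf_positive)

lemma feasible_nonneg: "feasible s \<Longrightarrow> 0 \<le> s x"
  unfolding feasible_def by blast

lemma feasible_outside: "feasible s \<Longrightarrow> x \<notin> trade_region \<Theta> \<Longrightarrow> s x = 0"
  unfolding feasible_def by blast

lemma feasible_above: "feasible s \<Longrightarrow> t < p \<Longrightarrow> s (t, p) = 0"
  by (rule feasible_outside) (auto simp: trade_region_def)

lemma feasible_marginal: "feasible s \<Longrightarrow> t \<in> \<Theta> \<Longrightarrow> (\<Sum>p\<in>\<Theta>. s (t, p)) = pmf \<mu> t"
  by (simp add: feasible_def)

lemma feasible_support: "feasible s \<Longrightarrow> 0 < s (t, p) \<Longrightarrow> t \<in> \<Theta> \<and> p \<in> \<Theta> \<and> p \<le> t"
  using feasible_outside[of s "(t, p)"] by (auto simp: trade_region_def)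

lemma feasible_le_marginal: "feasible s \<Longrightarrow> s (t, p) \<le> pmf \<mu> t"
proof (cases "t \<in> \<Theta> \<and> p \<in> \<Theta>")
  case True
  assume s: "feasible s"
  have "s (t, p) \<le> (\<Sum>p\<in>\<Theta>. s (t, p))"
    using True finite_types feasible_nonneg[OF s] by (intro member_le_sum) auto
  then show ?thesis using feasible_marginal[OF s] True by simp
qed (auto simp: feasible_outside trade_region_def)

lemma revenue_diff_eq_slack:
  assumes "\<And>x. x \<notin> trade_region \<Theta> \<Longrightarrow> s x = 0"
  shows "revenue \<Theta> (\<lambda>t. s (t, p)) p - revenue \<Theta> (\<lambda>t. s (t, p)) q = slack s p q"
proof -
  have "(\<Sum>t | t \<in> \<Theta> \<and> p \<le> t. s (t, p)) = (\<Sum>t\<in>\<Theta>. s (t, p))"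
    using finite_types assms by (intro sum.mono_neutral_left) (auto simp: trade_region_def)
  moreover have "(\<Sum>t | t \<in> \<Theta> \<and> q \<le> t. s (t, p)) = (\<Sum>t\<in>\<Theta>. if q \<le> t then s (t, p) else 0)"
    using finite_types by (simp add: sum.inter_filter)
  ultimately show ?thesis
    by (auto simp: revenue_def slack_def sum_distrib_left sum_subtractf[symmetric] left_diff_distrib
        intro!: sum.cong)
qed

text \<open>For \<open>q \<le> p\<close> every coefficient of the sum is nonnegative: a lower price
  attracts no new buyers when all of the segment buys at \<open>p\<close> already.\<close>

lemma slack_nonneg:
  assumes "feasible s" "p \<in> \<Theta>" "q \<in> \<Theta>"
  shows "0 \<le> slack s p q"
proof (cases "p < q")
  case True
  then show ?thesis using assms by (simp add: feasible_def)
next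
  case False
  then show ?thesis
    unfolding slack_def using assms types_pos feasible_nonneg[OF assms(1)]
    by (intro sum_nonneg mult_nonneg_nonneg) (auto intro: less_imp_le)
qed

lemma trade_segmentations_iff: "\<sigma> \<in> trade_segmentations \<Theta> \<mu> \<longleftrightarrow> feasible (pmf \<sigma>)"
proof -
  have supp: "set_pmf \<sigma> \<subseteq> trade_region \<Theta> \<longleftrightarrow> (\<forall>x. x \<notin> trade_region \<Theta> \<longrightarrow> pmf \<sigma> x = 0)"
    unfolding set_pmf_eq by blast
  have sub: "trade_region \<Theta> \<subseteq> \<Theta> \<times> \<Theta>" by (auto simp: trade_region_def)
  have obedient: "obedient \<Theta> \<sigma> \<longleftrightarrow> (\<forall>p\<in>\<Theta>. \<forall>q\<in>\<Theta>. 0 \<le> slack (pmf \<sigma>) p q)"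
    if "\<forall>x. x \<notin> trade_region \<Theta> \<longrightarrow> pmf \<sigma> x = 0"
  proof -
    have "slack (pmf \<sigma>) p q =
        revenue \<Theta> (\<lambda>t. pmf \<sigma> (t, p)) p - revenue \<Theta> (\<lambda>t. pmf \<sigma> (t, p)) q" for p q
      by (rule revenue_diff_eq_slack[symmetric]) (use that in blast)
    then show ?thesis by (simp add: obedient_def)
  qed
  show ?thesis
  proof
    assume "\<sigma> \<in> trade_segmentations \<Theta> \<mu>"
    then show "feasible (pmf \<sigma>)"
      using supp obedient
      by (simp add: feasible_def trade_segmentations_def segmentations_def del: split_paired_All)
  next
    assume f: "feasible (pmf \<sigma>)"
    then have "set_pmf \<sigma> \<subseteq> trade_region \<Theta>" using supp feasible_outside by blast
    then show "\<sigma> \<in> trade_segmentations \<Theta> \<mu>"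
      using supp obedient slack_nonneg[OF f] feasible_marginal[OF f] sub
      by (simp add: trade_segmentations_def segmentations_def subset_trans[OF _ sub]
          del: split_paired_All)
  qed
qed

lemma feasible_imp_pmf:
  assumes s: "feasible s"
  obtains \<sigma> where "pmf \<sigma> = s"
proof -
  have "(\<Sum>x\<in>\<Theta> \<times> \<Theta>. s x) = (\<Sum>t\<in>\<Theta>. \<Sum>p\<in>\<Theta>. s (t, p))"
    by (simp add: sum.cartesian_product)
  also have "\<dots> = (\<Sum>t\<in>\<Theta>. pmf \<mu> t)" by (simp add: feasible_marginal[OF s])
  also have "\<dots> = 1" using finite_types full_support by (intro sum_pmf_eq_1) auto
  finally have sum1: "(\<Sum>x\<in>\<Theta> \<times> \<Theta>. s x) = 1" .
  have "(\<integral>\<^sup>+x. ennreal (s x) \<partial>count_space UNIV) = (\<Sum>x\<in>\<Theta> \<times> \<Theta>. ennreal (s x))"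
  proof (rule nn_integral_count_space')
    fix x assume "x \<notin> \<Theta> \<times> \<Theta>"
    then have "x \<notin> trade_region \<Theta>" by (auto simp: trade_region_def)
    then show "ennreal (s x) = 0" using feasible_outside[OF s] by simp
  qed (use finite_types in auto)
  also have "\<dots> = 1" using sum1 feasible_nonneg[OF s] by (subst sum_ennreal) auto
  finally have "pmf (embed_pmf s) = s"
    using feasible_nonneg[OF s] by (intro ext pmf_embed_pmf) auto
  then show thesis using that by blast
qed

lemma next_type:
  assumes "u \<in> \<Theta>" "t < u"
  shows "next_type \<Theta> t \<in> \<Theta>" "t < next_type \<Theta> t" "next_type \<Theta> t \<le> u"
proof -
  have "next_type \<Theta> t \<in> {t' \<in> \<Theta>. t < t'}"
    unfolding next_type_def using finite_types assms by (intro Min_in) auto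
  then show "next_type \<Theta> t \<in> \<Theta>" "t < next_type \<Theta> t" by auto
  show "next_type \<Theta> t \<le> u"
    unfolding next_type_def using finite_types assms by (intro Min_le) auto
qed

text \<open>If type \<open>p\<close> were absent from the segment \<open>p\<close>, raising the
  price to the next type would lose no buyer and break obedience. A positive diagonal entry thus
  serves as the test for a nonempty segment.\<close>

lemma diagonal_pos:
  assumes s: "feasible s" and st: "0 < s (t, p)"
  shows "0 < s (p, p)"
proof (rule ccontr)
  assume "\<not> 0 < s (p, p)"
  then have pp: "s (p, p) = 0" using feasible_nonneg[OF s] by (metis order_le_less)
  have in\<Theta>: "t \<in> \<Theta>" "p \<in> \<Theta>" "p \<le> t" using feasible_support[OF s st] by auto
  have "p < t" using in\<Theta> pp st by (cases "p = t") auto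
  define q where "q = next_type \<Theta> p"
  have q: "q \<in> \<Theta>" "p < q" and qmin: "\<And>x. x \<in> \<Theta> \<Longrightarrow> p < x \<Longrightarrow> q \<le> x"
    using next_type[OF in\<Theta>(1) \<open>p < t\<close>] next_type(3) by (auto simp: q_def)
  have "slack s p q = (\<Sum>x\<in>\<Theta>. (p - q) * s (x, p))"
    unfolding slack_def
  proof (intro sum.cong refl)
    fix x assume "x \<in> \<Theta>"
    then show "(p - (if q \<le> x then q else 0)) * s (x, p) = (p - q) * s (x, p)"
      using qmin[of x] pp feasible_above[OF s, of x p] by (cases x p rule: linorder_cases) auto
  qed
  also have "\<dots> = (p - q) * (\<Sum>x\<in>\<Theta>. s (x, p))" by (simp add: sum_distrib_left)
  also have "\<dots> < 0"
    using q st in\<Theta> finite_types feasible_nonneg[OF s]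
    by (intro mult_neg_pos sum_pos2[of _ t]) auto
  finally show False using slack_nonneg[OF s in\<Theta>(2) q(1)] by simp
qed

lemma column_zero: "feasible s \<Longrightarrow> s (p, p) = 0 \<Longrightarrow> s (t, p) = 0"
  using diagonal_pos[of s t p] feasible_nonneg[of s "(t, p)"] by (metis less_irrefl order_le_less)

lemma slack_self: "feasible s \<Longrightarrow> slack s p p = 0"
  unfolding slack_def by (intro sum.neutral) (auto simp: feasible_above)

section \<open>The uniform price and the rent\<close>

abbreviation base :: real where "base \<equiv> Min \<Theta>"

abbreviation price :: real where "price \<equiv> uniform_price \<Theta> \<mu>"

lemma base: "base \<in> \<Theta>" "t \<in> \<Theta> \<Longrightarrow> base \<le> t"
  using finite_types types_nonempty by auto

lemma price_in: "price \<in> \<Theta>"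
  using uniform_price_is_arg_max[OF finite_types types_nonempty, of \<mu>] by (simp add: is_arg_max_def)

text \<open>Strictness comes from the uniform price being the smallest maximizer.\<close>

lemma revenue_below_price:
  assumes "p \<in> \<Theta>" "p < price"
  shows "revenue \<Theta> (pmf \<mu>) p < revenue \<Theta> (pmf \<mu>) price"
proof (rule ccontr)
  let ?S = "{p. is_arg_max (revenue \<Theta> (pmf \<mu>)) (\<lambda>p. p \<in> \<Theta>) p}"
  assume "\<not> ?thesis"
  then have "p \<in> ?S"
    using uniform_price_is_arg_max[OF finite_types types_nonempty, of \<mu>] assms(1)
    by (force simp: is_arg_max_linorder)
  moreover have "finite ?S"
    by (rule finite_subset[OF _ finite_types]) (auto simp: is_arg_max_def)
  ultimately have "price \<le> p" unfolding uniform_price_def by (intro Min_le)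
  then show False using assms(2) by simp
qed

text \<open>By the marginal condition, charging \<open>price\<close> in every segment earns exactly
  the uniform revenue.\<close>

lemma gives_rent_iff:
  assumes s: "feasible (pmf \<sigma>)"
  shows "gives_rent \<Theta> \<mu> \<sigma> \<longleftrightarrow> 0 < (\<Sum>p\<in>\<Theta>. slack (pmf \<sigma>) p price)"
proof -
  have "(\<Sum>p\<in>\<Theta>. revenue \<Theta> (\<lambda>t. pmf \<sigma> (t, p)) price) =
      price * (\<Sum>t | t \<in> \<Theta> \<and> price \<le> t. \<Sum>p\<in>\<Theta>. pmf \<sigma> (t, p))"
    unfolding revenue_def sum_distrib_left[symmetric] by (subst sum.swap) simp
  also have "\<dots> = revenue \<Theta> (pmf \<mu>) price"
    unfolding revenue_def using feasible_marginal[OF s] by simp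
  finally have "(\<Sum>p\<in>\<Theta>. slack (pmf \<sigma>) p price) =
      (\<Sum>p\<in>\<Theta>. revenue \<Theta> (\<lambda>t. pmf \<sigma> (t, p)) p) - revenue \<Theta> (pmf \<mu>) price"
    using revenue_diff_eq_slack[of "pmf \<sigma>", OF feasible_outside[OF s], symmetric]
    by (simp add: sum_subtractf)
  then show ?thesis by (simp add: gives_rent_def)
qed

lemma feasible_two_columns:
  assumes s: "feasible s" and zero: "\<And>p. \<lbrakk>p \<in> \<Theta>; p \<noteq> base; p \<noteq> price\<rbrakk> \<Longrightarrow> s (p, p) = 0"
    and t: "t \<in> \<Theta>"
  shows "base \<noteq> price \<Longrightarrow> s (t, base) + s (t, price) = pmf \<mu> t"
    and "base = price \<Longrightarrow> s (t, base) = pmf \<mu> t"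
proof -
  have "(\<Sum>p\<in>{base, price}. s (t, p)) = (\<Sum>p\<in>\<Theta>. s (t, p))"
    using finite_types base(1) price_in column_zero[OF s zero]
    by (intro sum.mono_neutral_left) auto
  then have *: "(\<Sum>p\<in>{base, price}. s (t, p)) = pmf \<mu> t" using feasible_marginal[OF s t] by simp
  show "base \<noteq> price \<Longrightarrow> s (t, base) + s (t, price) = pmf \<mu> t"
    and "base = price \<Longrightarrow> s (t, base) = pmf \<mu> t" using * by auto
qed

text \<open>Otherwise all buyers would face the lowest price, making it a uniform optimal price.\<close>

lemma price_diagonal_pos:
  assumes s: "feasible s" and zero: "\<And>p. \<lbrakk>p \<in> \<Theta>; p \<noteq> base; p \<noteq> price\<rbrakk> \<Longrightarrow> s (p, p) = 0"
    and "base < price"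
  shows "0 < s (price, price)"
proof (rule ccontr)
  assume "\<not> ?thesis"
  then have "s (price, price) = 0" using feasible_nonneg[OF s] by (metis order_le_less)
  then have "s (t, base) = pmf \<mu> t" if "t \<in> \<Theta>" for t
    using feasible_two_columns(1)[OF s zero that] column_zero[OF s, of price t] \<open>base < price\<close> by auto
  then have "revenue \<Theta> (\<lambda>t. s (t, base)) p = revenue \<Theta> (pmf \<mu>) p" for p
    by (simp add: revenue_def)
  then have "slack s base price < 0"
    using revenue_diff_eq_slack[of s base price, OF feasible_outside[OF s]]
      revenue_below_price[OF base(1) \<open>base < price\<close>] by simp
  then show False using slack_nonneg[OF s base(1) price_in] by simp
qed

text \<open>Setting this slack to zero and solving for \<open>s (price, base)\<close> gives the
  second argument of the minimum in \<open>base_share\<close>.\<close>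

lemma base_column_slack:
  assumes "\<And>t. \<lbrakk>t \<in> \<Theta>; t < price\<rbrakk> \<Longrightarrow> s (t, base) = pmf \<mu> t"
    and "\<And>t. \<lbrakk>t \<in> \<Theta>; price < t\<rbrakk> \<Longrightarrow> s (t, base) = 0"
  shows "slack s base price =
    base * (\<Sum>t | t \<in> \<Theta> \<and> t < price. pmf \<mu> t) - (price - base) * s (price, base)"
proof -
  have "slack s base price = (\<Sum>t\<in>\<Theta>. (if t < price then base * pmf \<mu> t else 0) +
      (if t = price then (base - price) * s (price, base) else 0))"
    unfolding slack_def using assms by (intro sum.cong refl) auto
  also have "\<dots> = (\<Sum>t\<in>\<Theta>. if t < price then base * pmf \<mu> t else 0) + (base - price) * s (price, base)"
    using finite_types price_in by (simp add: sum.distrib)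
  also have "(\<Sum>t\<in>\<Theta>. if t < price then base * pmf \<mu> t else 0) =
      base * (\<Sum>t | t \<in> \<Theta> \<and> t < price. pmf \<mu> t)"
    unfolding sum_distrib_left using finite_types by (simp add: sum.inter_filter)
  finally show ?thesis by (simp add: algebra_simps)
qed

section \<open>The candidate \<open>sigma_star\<close>\<close>

definition base_share :: real where
  "base_share = min (pmf \<mu> price) (base / (price - base) * (\<Sum>t | t \<in> \<Theta> \<and> t < price. pmf \<mu> t))"

abbreviation star :: "real \<times> real \<Rightarrow> real" where "star \<equiv> sigma_star_density \<Theta> \<mu>"

lemma star_eq:
  "star (t, p) =
     (if price = base then (if p = base then pmf \<mu> t else 0)
      else if p = base then (if t < price then pmf \<mu> t else if t = price then base_share else 0)
      else if p = price then (if t = price then pmf \<mu> price - base_share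
        else if t > price then pmf \<mu> t else 0)
      else 0)"
  unfolding sigma_star_density_def Let_def base_share_def by simp

lemma pmf_star: "pmf (sigma_star \<Theta> \<mu>) = star"
  using pmf_sigma_star finite_types types_pos full_support by blast

text \<open>Support and marginals are right by construction, so obedience alone is at stake.\<close>

lemma obedient_star_iff: "obedient \<Theta> (sigma_star \<Theta> \<mu>) \<longleftrightarrow> feasible star"
proof -
  have outside: "star x = 0" if "x \<notin> trade_region \<Theta>" for x
  proof (cases x)
    case (Pair t p)
    have "pmf \<mu> t = 0" if "t \<notin> \<Theta>" using that full_support by (metis set_pmf_iff)
    then show ?thesis
      using that Pair base(1) base(2)[of t] base(2)[OF price_in] price_in
      by (cases "t \<in> \<Theta>") (auto simp: star_eq trade_region_def not_le)
  qed
  have marginal: "(\<Sum>p\<in>\<Theta>. star (t, p)) = pmf \<mu> t" if "t \<in> \<Theta>" for t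
  proof -
    have "(\<Sum>p\<in>\<Theta>. star (t, p)) = (\<Sum>p\<in>{base, price}. star (t, p))"
      using finite_types base(1) price_in
      by (intro sum.mono_neutral_right) (auto simp: star_eq)
    also have "\<dots> = pmf \<mu> t" by (cases "price = base") (auto simp: star_eq)
    finally show ?thesis .
  qed
  have "set_pmf (sigma_star \<Theta> \<mu>) \<subseteq> trade_region \<Theta>"
    using outside unfolding set_pmf_eq pmf_star by blast
  then have "obedient \<Theta> (sigma_star \<Theta> \<mu>) \<longleftrightarrow> sigma_star \<Theta> \<mu> \<in> trade_segmentations \<Theta> \<mu>"
    using marginal
    by (auto simp: trade_segmentations_def segmentations_def pmf_star trade_region_def)
  then show ?thesis by (simp add: trade_segmentations_iff pmf_star)
qed

text \<open>Only the lowest segment needs an argument when \<open>base < price\<close>. By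
  \<open>price_diagonal_pos\<close> some of type \<open>price\<close> stays in its own segment, so
  the minimum in \<open>base_share\<close> is its second argument, the value at which the constraint
  binds.\<close>

lemma star_slack_zero:
  assumes s: "feasible star" and p: "p \<in> \<Theta>"
  shows "slack star p price = 0"
proof (cases "p = price")
  case True
  then show ?thesis using slack_self[OF s] by simp
next
  case False
  show ?thesis
  proof (cases "p = base")
    case True
    then have "base < price" using False base(2)[OF price_in] by simp
    have "0 < star (price, price)"
      by (rule price_diagonal_pos[OF s _ \<open>base < price\<close>]) (simp add: star_eq)
    then have "base_share < pmf \<mu> price" using \<open>base < price\<close> by (simp add: star_eq)
    then have "(price - base) * base_share = base * (\<Sum>t | t \<in> \<Theta> \<and> t < price. pmf \<mu> t)"
      using \<open>base < price\<close> by (auto simp: base_share_def min_def)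
    moreover have "slack star base price =
        base * (\<Sum>t | t \<in> \<Theta> \<and> t < price. pmf \<mu> t) - (price - base) * star (price, base)"
      using \<open>base < price\<close> by (intro base_column_slack) (simp_all add: star_eq)
    ultimately show ?thesis using True \<open>base < price\<close> by (simp add: star_eq)
  next
    case False
    then show ?thesis
      using \<open>p \<noteq> price\<close> by (cases "price = base") (simp_all add: slack_def star_eq)
  qed
qed

end

section \<open>The welfare problem and existence of a maximizer\<close>

locale redistributive_market = market +
  fixes w :: "real \<Rightarrow> real \<Rightarrow> real"
  assumes strong: "strongly_redistributive \<Theta> w"
begin

definition payoff :: "(real \<times> real \<Rightarrow> real) \<Rightarrow> real" where
  "payoff s = (\<Sum>(t, p)\<in>\<Theta> \<times> \<Theta>. w t p * s (t, p))"

definition maximal :: "(real \<times> real \<Rightarrow> real) \<Rightarrow> bool" where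
  "maximal s \<longleftrightarrow> feasible s \<and> (\<forall>s'. feasible s' \<longrightarrow> payoff s' \<le> payoff s)"

lemma optimal_iff: "optimal \<Theta> w \<mu> \<sigma> \<longleftrightarrow> maximal (pmf \<sigma>)"
proof -
  have "welfare \<Theta> w \<tau> = payoff (pmf \<tau>)" for \<tau>
    by (simp add: welfare_def payoff_def)
  moreover have "(\<forall>\<tau>. feasible (pmf \<tau>) \<longrightarrow> payoff (pmf \<tau>) \<le> c) \<longleftrightarrow> (\<forall>s. feasible s \<longrightarrow> payoff s \<le> c)" for c
    using feasible_imp_pmf by metis
  ultimately show ?thesis
    unfolding optimal_def is_arg_max_linorder trade_segmentations_iff maximal_def by simp
qed

lemma maximal_feasible: "maximal s \<Longrightarrow> feasible s"
  by (simp add: maximal_def)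

text \<open>A continuous function attains its maximum on a nonempty compact set. In the product
  topology the box of functions with values in [0,1] is compact by Tychonoff, and the constraints
  cut out a closed subset.\<close>

lemma maximal_exists: "\<exists>s. maximal s"
proof -
  have coord: "continuous_on UNIV (\<lambda>s::real \<times> real \<Rightarrow> real. s x)" for x
    by (rule continuous_on_product_coordinates)
  have box: "compact (Pi\<^sub>E UNIV (\<lambda>_::real \<times> real. {0..1::real}))"
    using compactin_PiE[of "\<lambda>_. euclidean" UNIV "\<lambda>_. {0..1::real}"]
    by (simp add: euclidean_product_topology)
  have eq: "Collect feasible = Pi\<^sub>E UNIV (\<lambda>_. {0..1}) \<inter>
      ({s. \<forall>x\<in>-trade_region \<Theta>. s x = 0} \<inter> {s. \<forall>t\<in>\<Theta>. (\<Sum>p\<in>\<Theta>. s (t, p)) = pmf \<mu> t} \<inter>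
       {s. \<forall>p\<in>\<Theta>. \<forall>q\<in>{q \<in> \<Theta>. p < q}. 0 \<le> slack s p q})"
  proof -
    have "s x \<le> 1" if "feasible s" for s x
      using feasible_le_marginal[OF that] pmf_le_1 by (metis order_trans surj_pair)
    then show ?thesis by (auto simp: PiE_def Pi_def feasible_def extensional_def)
  qed
  have closed1: "closed {s::real \<times> real \<Rightarrow> real. \<forall>x\<in>-trade_region \<Theta>. s x = 0}"
    unfolding Collect_ball_eq
    by (intro closed_INT ballI closed_Collect_eq coord continuous_intros)
  have closed2: "closed {s. \<forall>t\<in>\<Theta>. (\<Sum>p\<in>\<Theta>. s (t, p)) = pmf \<mu> t}"
    unfolding Collect_ball_eq
    by (intro closed_INT ballI closed_Collect_eq continuous_on_sum coord continuous_on_const)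
  have closed3: "closed {s. \<forall>p\<in>\<Theta>. \<forall>q\<in>{q \<in> \<Theta>. p < q}. 0 \<le> slack s p q}"
    unfolding slack_def Collect_ball_eq
    by (intro closed_INT ballI closed_Collect_le continuous_on_sum continuous_on_mult coord
        continuous_on_const)
  have "compact (Collect feasible)"
    unfolding eq by (intro compact_Int_closed closed_Int box closed1 closed2 closed3)
  moreover have "Collect feasible \<noteq> {}"
  proof -
    \<comment> \<open>Perfect price discrimination: each type forms its own segment.\<close>
    let ?s = "\<lambda>(t, p). if t = p then pmf \<mu> t else 0"
    have "feasible ?s"
      unfolding feasible_def
    proof (intro conjI ballI allI impI)
      fix x assume "x \<notin> trade_region \<Theta>"
      moreover have "pmf \<mu> t = 0" if "t \<notin> \<Theta>" for t
        using that full_support by (metis set_pmf_iff)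
      ultimately show "?s x = 0" by (cases x) (auto simp: trade_region_def)
    next
      fix p q assume "p \<in> \<Theta>" "p < q"
      then show "0 \<le> slack ?s p q"
        unfolding slack_def using types_pos[of p] by (intro sum_nonneg) auto
    qed (use finite_types in auto)
    then show ?thesis by blast
  qed
  moreover have "continuous_on (Collect feasible) payoff"
    unfolding payoff_def case_prod_unfold
    by (intro continuous_on_sum continuous_on_mult continuous_on_const
        continuous_on_subset[OF coord]) auto
  ultimately show ?thesis
    using continuous_attains_sup[of "Collect feasible" payoff] unfolding maximal_def by auto
qed

section \<open>Perturbations of a maximizer\<close>

lemma slack_linear: "slack (\<lambda>x. f x + c * g x) p q = slack f p q + c * slack g p q"
  by (simp add: slack_def distrib_left sum.distrib sum_distrib_left mult.left_commute)

lemma slack_indicator: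
  assumes "a \<in> \<Theta>"
  shows "slack (indicator {(a, b)}) p q = (if p = b then p - (if q \<le> a then q else 0) else 0)"
proof -
  have "slack (indicator {(a, b)}) p q =
      (\<Sum>t\<in>\<Theta>. if t = a then (if p = b then p - (if q \<le> a then q else 0) else 0) else 0)"
    unfolding slack_def by (intro sum.cong) (auto simp: indicator_def)
  then show ?thesis using assms finite_types by simp
qed

lemma payoff_linear: "payoff (\<lambda>x. f x + c * g x) = payoff f + c * payoff g"
  by (simp add: payoff_def sum.distrib sum_distrib_left algebra_simps case_prod_unfold)

lemma payoff_indicator:
  assumes "a \<in> \<Theta>" "b \<in> \<Theta>"
  shows "payoff (indicator {(a, b)}) = w a b"
proof -
  have "payoff (indicator {(a, b)}) = (\<Sum>x\<in>\<Theta> \<times> \<Theta>. if x = (a, b) then w a b else 0)"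
    unfolding payoff_def by (intro sum.cong) (auto simp: indicator_def)
  then show ?thesis using assms finite_types by simp
qed

text \<open>The welfare problem is a linear program: a direction that respects the binding constraints is
  feasible for a small step.\<close>

lemma maximal_direction:
  assumes max: "maximal s"
    and outside: "\<And>x. x \<notin> trade_region \<Theta> \<Longrightarrow> d x = 0"
    and marginal: "\<And>t. t \<in> \<Theta> \<Longrightarrow> (\<Sum>p\<in>\<Theta>. d (t, p)) = 0"
    and zero: "\<And>x. s x = 0 \<Longrightarrow> 0 \<le> d x"
    and tight: "\<And>p q. \<lbrakk>p \<in> \<Theta>; q \<in> \<Theta>; p < q; slack s p q = 0\<rbrakk> \<Longrightarrow> 0 \<le> slack d p q"
  shows "payoff d \<le> 0"
proof -
  have s: "feasible s" using max by (rule maximal_feasible)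
  \<comment> \<open>There are finitely many inequalities, each valid for all small steps, so one
    step \<open>e\<close> serves them all.\<close>
  have "finite (trade_region \<Theta>)"
    by (rule finite_subset[of _ "\<Theta> \<times> \<Theta>"]) (auto simp: trade_region_def finite_types)
  then have "\<forall>\<^sub>F e in at_right 0. \<forall>x\<in>trade_region \<Theta>. 0 \<le> s x + e * d x"
    using eventually_affine_nonneg feasible_nonneg[OF s] zero by (simp add: eventually_ball_finite)
  moreover have "\<forall>\<^sub>F e in at_right 0. \<forall>p\<in>\<Theta>. \<forall>q\<in>{q \<in> \<Theta>. p < q}. 0 \<le> slack s p q + e * slack d p q"
    by (intro eventually_ball_finite ballI eventually_affine_nonneg)
      (use finite_types slack_nonneg[OF s] tight in auto)
  moreover have "\<forall>\<^sub>F e in at_right 0. (0::real) < e" by (rule eventually_at_right_less)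
  ultimately have "\<forall>\<^sub>F e in at_right 0. 0 < e \<and> (\<forall>x\<in>trade_region \<Theta>. 0 \<le> s x + e * d x) \<and>
      (\<forall>p\<in>\<Theta>. \<forall>q\<in>{q \<in> \<Theta>. p < q}. 0 \<le> slack s p q + e * slack d p q)"
    by eventually_elim simp
  then obtain e where e: "0 < e" "\<And>x. x \<in> trade_region \<Theta> \<Longrightarrow> 0 \<le> s x + e * d x"
      "\<And>p q. \<lbrakk>p \<in> \<Theta>; q \<in> \<Theta>; p < q\<rbrakk> \<Longrightarrow> 0 \<le> slack s p q + e * slack d p q"
    using eventually_happens'[OF trivial_limit_at_right_real] by blast
  have "0 \<le> s x + e * d x" for x
    using e(2)[of x] feasible_outside[OF s, of x] outside[of x]
    by (cases "x \<in> trade_region \<Theta>") auto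
  moreover have "(\<Sum>p\<in>\<Theta>. s (t, p) + e * d (t, p)) = pmf \<mu> t" if "t \<in> \<Theta>" for t
    using that marginal feasible_marginal[OF s] by (simp add: sum.distrib flip: sum_distrib_left)
  ultimately have "feasible (\<lambda>x. s x + e * d x)"
    using e(3) feasible_outside[OF s] outside
    unfolding feasible_def slack_linear by simp
  then have "payoff s + e * payoff d \<le> payoff s"
    using max unfolding maximal_def payoff_linear[symmetric] by blast
  then show ?thesis using e(1) by (simp add: mult_le_0_iff)
qed

lemma w_strict_antimono:
  assumes "t \<in> \<Theta>" "p \<in> \<Theta>" "q \<in> \<Theta>" "p < q" "q \<le> t"
  shows "w t q < w t p"
proof -
  have "strict_antimono_on {p \<in> \<Theta>. p \<le> t} (w t)"
    using strong assms(1) by (simp add: strongly_redistributive_def strictly_redistributive_def)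
  then show ?thesis using assms by (auto simp: monotone_on_def)
qed

lemma w_decreasing_differences:
  assumes "t \<in> \<Theta>" "t' \<in> \<Theta>" "p \<in> \<Theta>" "q \<in> \<Theta>" "p < q" "q \<le> t" "t < t'"
  shows "w t' p - w t' q < w t p - w t q"
  using strong assms by (simp add: strongly_redistributive_def strictly_redistributive_def)

lemma w_strong:
  assumes "p \<in> \<Theta>" "t \<in> \<Theta>" "u \<in> \<Theta>" "p < t" "t < u"
  shows "next_type \<Theta> t / (next_type \<Theta> t - t) * (w u t - w u u)
    < (w t p - w t t) - (w (next_type \<Theta> t) p - w (next_type \<Theta> t) t)"
  using strong assms by (simp add: strongly_redistributive_def Let_def)

text \<open>The move from the segment \<open>t\<close> to the segment \<open>p\<close>: without exchange if \<open>\<eta> = 0\<close>, against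
  a higher type \<open>t'\<close> if \<open>\<eta> = 1\<close>.\<close>

lemma no_improving_exchange:
  fixes \<eta> :: real
  assumes max: "maximal s" and p: "p \<in> \<Theta>" "p < t" and st: "0 < s (t, t)"
    and \<eta>: "\<eta> = 0 \<and> t' = t \<and> (\<forall>q\<in>\<Theta>. p < q \<and> q \<le> t \<longrightarrow> 0 < slack s p q) \<or>
      \<eta> = 1 \<and> t < t' \<and> 0 < s (t', p)"
  shows False
proof -
  have s: "feasible s" using max by (rule maximal_feasible)
  have t: "t \<in> \<Theta>" using feasible_support[OF s st] by simp
  have t': "t' \<in> \<Theta>" "t \<le> t'" using \<eta> t feasible_support[OF s, of t' p] by auto
  \<comment> \<open>The highest type in the segment \<open>t\<close>: no constraint for a price
    above \<open>u\<close> can bind there.\<close>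
  define u where "u = Max {x \<in> \<Theta>. 0 < s (x, t)}"
  have "finite {x \<in> \<Theta>. 0 < s (x, t)}" "t \<in> {x \<in> \<Theta>. 0 < s (x, t)}"
    using finite_types st t by auto
  then have "u \<in> {x \<in> \<Theta>. 0 < s (x, t)}" and
    umax: "\<And>x. x \<in> \<Theta> \<Longrightarrow> 0 < s (x, t) \<Longrightarrow> x \<le> u"
    using Max_in[of "{x \<in> \<Theta>. 0 < s (x, t)}"] Max_ge[of "{x \<in> \<Theta>. 0 < s (x, t)}"]
    unfolding u_def by blast+
  then have u: "u \<in> \<Theta>" "0 < s (u, t)" "t \<le> u" using t st by auto
  define n where "n = next_type \<Theta> t"
  have n: "t < u \<Longrightarrow> n \<in> \<Theta>" "t < u \<Longrightarrow> t < n" "q \<in> \<Theta> \<Longrightarrow> t < q \<Longrightarrow> n \<le> q" for q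
    using next_type u(1) by (auto simp: n_def)
  \<comment> \<open>\<open>q / (q - t)\<close> decreases in \<open>q\<close>, so the rate required by the next type \<open>n\<close> suffices for all \<open>q\<close>.\<close>
  define \<kappa> where "\<kappa> = (if t < u then n / (n - t) else 0)"
  have \<kappa>0: "0 \<le> \<kappa>" using n types_pos by (auto simp: \<kappa>_def intro!: divide_nonneg_nonneg less_imp_le)
  \<comment> \<open>One unit of type \<open>t\<close> goes from segment \<open>t\<close> to
    \<open>p\<close>, \<open>\<eta>\<close> units of \<open>t'\<close> come back, and
    \<open>\<kappa>\<close> units of \<open>u\<close> leave for their own segment. Signs are written
    as factors so that \<open>slack_linear\<close> and \<open>payoff_linear\<close> unfold the chain
    term by term.\<close>
  define d :: "real \<times> real \<Rightarrow> real" where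
    "d = (\<lambda>x. indicat_real {(t, p)} x + (- 1) * indicat_real {(t, t)} x +
       (- \<eta>) * indicat_real {(t', p)} x + \<eta> * indicat_real {(t', t)} x +
       \<kappa> * indicat_real {(u, u)} x + (- \<kappa>) * indicat_real {(u, t)} x)"
  have payoff_d: "payoff d = w t p - w t t - \<eta> * (w t' p - w t' t) - \<kappa> * (w u t - w u u)"
    unfolding d_def payoff_linear using payoff_indicator t t' u p by (simp add: algebra_simps)
  have slack_d: "slack d x q = (if x = p then (p - (if q \<le> t then q else 0)) else 0)
      - (if x = t then (t - (if q \<le> t then q else 0)) else 0)
      - \<eta> * (if x = p then (p - (if q \<le> t' then q else 0)) else 0)
      + \<eta> * (if x = t then (t - (if q \<le> t' then q else 0)) else 0)
      + \<kappa> * (if x = u then (u - (if q \<le> u then q else 0)) else 0)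
      - \<kappa> * (if x = t then (t - (if q \<le> u then q else 0)) else 0)" for x q
    unfolding d_def slack_linear using slack_indicator t t' u p by simp
  have "payoff d \<le> 0"
  proof (rule maximal_direction[OF max])
    fix x assume "x \<notin> trade_region \<Theta>"
    then show "d x = 0" using t t' u p by (auto simp: d_def trade_region_def indicator_def)
  next
    fix y assume "y \<in> \<Theta>"
    have "(\<Sum>q\<in>\<Theta>. indicator {(a, b)} (y, q)) = (if y = a then 1 else 0::real)" if "b \<in> \<Theta>" for a b
      using that finite_types by (simp add: indicator_def)
    then show "(\<Sum>q\<in>\<Theta>. d (y, q)) = 0"
      using t t' u p by (simp add: d_def sum.distrib sum_subtractf flip: sum_distrib_left)
  next
    fix x assume "s x = 0"
    then have "x \<noteq> (t, t)" "x \<noteq> (u, t)" "\<eta> \<noteq> 0 \<Longrightarrow> x \<noteq> (t', p)"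
      using st u \<eta> by auto
    then show "0 \<le> d x" using \<eta> \<kappa>0 by (auto simp: d_def indicator_def)
  next
    fix x q assume x: "x \<in> \<Theta>" and q: "q \<in> \<Theta>" and xq: "x < q" and sl: "slack s x q = 0"
    have "0 < q" using q types_pos by simp
    consider "x = p" | "x = t" | "x = u" "x \<noteq> t" | "x \<notin> {p, t, u}" by blast
    then show "0 \<le> slack d x q"
    proof cases
      case 1
      then have "u \<noteq> p" "t \<noteq> p" using p u by auto
      \<comment> \<open>Without exchange, a binding \<open>q\<close> lies above \<open>t\<close>, so
        the newcomers would not pay it and the slack grows. With exchange, a lower type replaces a
        higher one, which cannot make a deviation more attractive.\<close>
      moreover have "\<eta> = 0 \<Longrightarrow> t < q" using \<eta> sl q xq 1 by force
      ultimately show ?thesis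
        using 1 \<eta> \<open>0 < q\<close> t' types_pos[OF p(1)] by (auto simp: slack_d)
    next
      case 2
      \<comment> \<open>At a price above \<open>u\<close> nobody in the segment buys, so the
        constraint would be strictly slack.\<close>
      have qu: "q \<le> u"
      proof (rule ccontr)
        assume "\<not> q \<le> u"
        then have "slack s t q = (\<Sum>y\<in>\<Theta>. t * s (y, t))"
          unfolding slack_def
          using umax feasible_nonneg[OF s] by (intro sum.cong refl) (force simp: order_le_less)
        also have "\<dots> > 0"
          using st t types_pos[OF t] finite_types feasible_nonneg[OF s]
          by (intro sum_pos2[of _ t]) auto
        finally show False using sl 2 by simp
      qed
      have tq: "t < q" using xq 2 by simp
      have tu: "t < u" using tq qu by simp
      have "q * (n - t) \<le> n * (q - t)"
        using n(3)[OF q tq] types_pos[OF t] by (simp add: algebra_simps)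
      then have \<kappa>q: "q \<le> \<kappa> * (q - t)"
        using tu n(2)[OF tu] by (simp add: \<kappa>_def field_simps)
      \<comment> \<open>The worst case is an exchange with \<open>q \<le> t'\<close>: it costs
        exactly \<open>q\<close>, which the departure of type \<open>u\<close> repays.\<close>
      have "slack d x q = - t + \<eta> * (t - (if q \<le> t' then q else 0)) + \<kappa> * (q - t)"
        using 2 p tq qu tu by (simp add: slack_d algebra_simps)
      then show ?thesis using \<kappa>q \<eta> tq types_pos[OF t] by auto
    next
      case 3
      then show ?thesis using p u(3) xq types_pos[OF u(1)] \<kappa>0 by (simp add: slack_d)
    qed (simp add: slack_d)
  qed
  moreover have "0 < payoff d"
  proof (cases "t < u")
    case True
    have "n / (n - t) * (w u t - w u u) < (w t p - w t t) - (w n p - w n t)"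
      using w_strong[OF p(1) t u(1) p(2) True] by (simp add: n_def)
    \<comment> \<open>The term for \<open>n\<close> in the strong inequality is positive, which
      settles \<open>\<eta> = 0\<close>; for \<open>\<eta> = 1\<close> it bounds the term for
      \<open>t'\<close>, since \<open>n \<le> t'\<close>.\<close>
    moreover have "0 < w n p - w n t"
      using w_strict_antimono[of n p t] n(1,2)[OF True] p t True by simp
    moreover have "w t' p - w t' t \<le> w n p - w n t" if "t < t'"
      using w_decreasing_differences[of n t' p t] n(1,2)[OF True] n(3)[OF t'(1) that] p t t'
      by (cases "n = t'") auto
    ultimately show ?thesis using \<eta> True by (auto simp: payoff_d \<kappa>_def)
  next
    case False
    then show ?thesis
      using \<eta> w_strict_antimono[of t p t] w_decreasing_differences[of t t' p t] p t t'
      by (auto simp: payoff_d \<kappa>_def)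
  qed
  ultimately show False by simp
qed

lemma maximal_monotone:
  assumes "maximal s" "p \<in> \<Theta>" "p < t" "0 < s (t, t)" "t < t'"
  shows "s (t', p) = 0"
  using no_improving_exchange[OF assms(1-4), of 1 t'] assms(5)
    feasible_nonneg[OF maximal_feasible[OF assms(1)]] by (metis order_le_less)

text \<open>If no constraint up to \<open>t\<close> were binding, type \<open>t\<close> could be
  moved down without exchange.\<close>

lemma maximal_saturated:
  assumes "maximal s" "p \<in> \<Theta>" "p < t" "0 < s (t, t)"
  obtains q where "q \<in> \<Theta>" "p < q" "q \<le> t" "slack s p q = 0"
  using no_improving_exchange[OF assms(1-4), of 0 t]
    slack_nonneg[OF maximal_feasible[OF assms(1)]] assms(2) by (metis order_le_less)

section \<open>Lexicographic maximality and uniqueness\<close>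

text \<open>If \<open>s'\<close> had more mass at \<open>(t, p)\<close>, then \<open>s\<close> would
  hold more of type \<open>t\<close> in some later segment \<open>y\<close>. So in \<open>s\<close>
  the segment \<open>p\<close> has no types above \<open>t\<close> and a binding constraint
  \<open>q \<le> y \<le> t\<close>. Compared with \<open>s\<close>, the column of \<open>s'\<close>
  adds mass only at types from \<open>t\<close> on, where the coefficient \<open>p - q\<close> is
  negative, and so violates this constraint.\<close>

lemma maximal_lex_ge:
  assumes max: "maximal s" and s': "feasible s'" and in\<Theta>: "p \<in> \<Theta>" "t \<in> \<Theta>"
    and columns: "\<And>y x. \<lbrakk>y \<in> \<Theta>; y < p; x \<in> \<Theta>\<rbrakk> \<Longrightarrow> s (x, y) = s' (x, y)"
    and types: "\<And>x. \<lbrakk>x \<in> \<Theta>; x < t\<rbrakk> \<Longrightarrow> s (x, p) = s' (x, p)"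
  shows "s' (t, p) \<le> s (t, p)"
proof (rule ccontr)
  assume "\<not> ?thesis"
  then have less: "s (t, p) < s' (t, p)" by simp
  have s: "feasible s" using max by (rule maximal_feasible)
  have "0 < s' (t, p)" using less feasible_nonneg[OF s, of "(t, p)"] by simp
  then have "p \<le> t" using feasible_support[OF s'] by blast
  have "\<exists>y\<in>\<Theta>. s' (t, y) < s (t, y)"
  proof (rule ccontr)
    assume "\<not> ?thesis"
    then have "(\<Sum>y\<in>\<Theta>. s (t, y)) < (\<Sum>y\<in>\<Theta>. s' (t, y))"
      using less in\<Theta>(1) finite_types by (intro sum_strict_mono_ex1) (auto simp: not_less)
    then show False using feasible_marginal[OF s in\<Theta>(2)] feasible_marginal[OF s' in\<Theta>(2)] by simp
  qed
  then obtain y where y: "y \<in> \<Theta>" "s' (t, y) < s (t, y)" by blast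
  have "0 < s (t, y)" using y(2) feasible_nonneg[OF s', of "(t, y)"] by simp
  then have diag: "0 < s (y, y)" and "y \<le> t"
    using diagonal_pos[OF s] feasible_support[OF s] by blast+
  have "p < y" using columns[of y t] y in\<Theta> less by (cases y p rule: linorder_cases) auto
  obtain q where q: "q \<in> \<Theta>" "p < q" "q \<le> y" "slack s p q = 0"
    using maximal_saturated[OF max in\<Theta>(1) \<open>p < y\<close> diag] .
  have above: "s (x, p) = 0" if "t < x" for x
    using maximal_monotone[OF max in\<Theta>(1) \<open>p < y\<close> diag] that \<open>y \<le> t\<close> by simp
  have "slack s' p q < slack s p q"
    unfolding slack_def
  proof (intro sum_strict_mono_ex1 ballI bexI)
    fix x assume x: "x \<in> \<Theta>"
    show "(p - (if q \<le> x then q else 0)) * s' (x, p) \<le> (p - (if q \<le> x then q else 0)) * s (x, p)"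
      using types[OF x] above[of x] less q \<open>y \<le> t\<close> feasible_nonneg[OF s', of "(x, p)"]
      by (cases x t rule: linorder_cases) (auto intro: mult_left_mono_neg mult_nonpos_nonneg)
  next
    show "(p - (if q \<le> t then q else 0)) * s' (t, p) < (p - (if q \<le> t then q else 0)) * s (t, p)"
      using less q \<open>y \<le> t\<close> by (simp add: mult_strict_left_mono_neg)
  qed (use finite_types in\<Theta> in auto)
  then show False using slack_nonneg[OF s' in\<Theta>(1) q(1)] q(4) by simp
qed

text \<open>At the lexicographically first disagreement, \<open>maximal_lex_ge\<close> gives one
  inequality and the assumption \<open>le\<close> the other.\<close>

lemma maximal_eqI:
  assumes max: "maximal s" and s': "feasible s'"
    and le: "\<And>p t. \<lbrakk>p \<in> \<Theta>; t \<in> \<Theta>; \<And>y x. \<lbrakk>y \<in> \<Theta>; y < p; x \<in> \<Theta>\<rbrakk> \<Longrightarrow> s (x, y) = s' (x, y);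
      \<And>x. \<lbrakk>x \<in> \<Theta>; x < t\<rbrakk> \<Longrightarrow> s (x, p) = s' (x, p)\<rbrakk> \<Longrightarrow> s (t, p) \<le> s' (t, p)"
  shows "s = s'"
proof -
  have s: "feasible s" using max by (rule maximal_feasible)
  have "s (t, p) = s' (t, p)" if "p \<in> \<Theta>" "t \<in> \<Theta>" for t p
  proof (rule ccontr)
    assume "s (t, p) \<noteq> s' (t, p)"
    define P where "P = {p \<in> \<Theta>. \<exists>t\<in>\<Theta>. s (t, p) \<noteq> s' (t, p)}"
    have P: "finite P" "P \<noteq> {}"
      using finite_types that \<open>s (t, p) \<noteq> s' (t, p)\<close> by (auto simp: P_def)
    define p0 where "p0 = Min P"
    have p0: "p0 \<in> P" "\<And>y. y \<in> P \<Longrightarrow> p0 \<le> y" using P by (simp_all add: p0_def)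
    define T where "T = {t \<in> \<Theta>. s (t, p0) \<noteq> s' (t, p0)}"
    have T: "finite T" "T \<noteq> {}" using finite_types p0(1) by (auto simp: T_def P_def)
    define t0 where "t0 = Min T"
    have t0: "t0 \<in> T" "\<And>x. x \<in> T \<Longrightarrow> t0 \<le> x" using T by (simp_all add: t0_def)
    have in\<Theta>: "p0 \<in> \<Theta>" "t0 \<in> \<Theta>" using p0(1) t0(1) by (auto simp: P_def T_def)
    have columns: "s (x, y) = s' (x, y)" if "y \<in> \<Theta>" "y < p0" "x \<in> \<Theta>" for x y
      using p0(2)[of y] that by (auto simp: P_def)
    have types: "s (x, p0) = s' (x, p0)" if "x \<in> \<Theta>" "x < t0" for x
      using t0(2)[of x] that by (auto simp: T_def)
    have "s (t0, p0) = s' (t0, p0)"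
      using le[OF in\<Theta> columns types] maximal_lex_ge[OF max s' in\<Theta> columns types] by simp
    then show False using t0(1) by (simp add: T_def)
  qed
  moreover have "s (t, p) = s' (t, p)" if "\<not> (p \<in> \<Theta> \<and> t \<in> \<Theta>)" for t p
    using that feasible_outside[OF s] feasible_outside[OF s'] by (simp add: trade_region_def)
  ultimately show ?thesis by (metis ext surj_pair)
qed

lemma maximal_unique:
  assumes "maximal s" "maximal s'"
  shows "s = s'"
  by (rule maximal_eqI[OF assms(1) maximal_feasible[OF assms(2)]])
    (rule maximal_lex_ge[OF assms(2) maximal_feasible[OF assms(1)]], simp_all)

section \<open>Comparison with \<open>sigma_star\<close>\<close>

text \<open>\<open>s'\<close> has placed the whole mass of type \<open>t\<close> by column
  \<open>p\<close>, so \<open>s\<close>, which agrees with it on that type before, has no more left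
  to place.\<close>

lemma le_of_exhausted:
  assumes s: "feasible s" and s': "feasible s'" and in\<Theta>: "p \<in> \<Theta>" "t \<in> \<Theta>"
    and columns: "\<And>y. \<lbrakk>y \<in> \<Theta>; y < p\<rbrakk> \<Longrightarrow> s (t, y) = s' (t, y)"
    and exhausted: "\<And>y. \<lbrakk>y \<in> \<Theta>; p < y\<rbrakk> \<Longrightarrow> s' (t, y) = 0"
  shows "s (t, p) \<le> s' (t, p)"
proof (rule ccontr)
  assume less: "\<not> ?thesis"
  have "s' (t, y) \<le> s (t, y)" if "y \<in> \<Theta>" for y
    using columns[of y] exhausted[of y] feasible_nonneg[OF s, of "(t, y)"] that less
    by (cases y p rule: linorder_cases) auto
  then have "(\<Sum>y\<in>\<Theta>. s' (t, y)) < (\<Sum>y\<in>\<Theta>. s (t, y))"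
    using less in\<Theta>(1) finite_types by (intro sum_strict_mono_ex1) (auto simp: not_le)
  then show False using feasible_marginal[OF s in\<Theta>(2)] feasible_marginal[OF s' in\<Theta>(2)] by simp
qed

text \<open>An excess of \<open>s\<close> at the first disagreement requires that
  \<open>star\<close> still holds some of type \<open>t\<close> for the segment
  \<open>price\<close>, so \<open>price \<le> t\<close>. In the lowest segment the excess would
  violate the constraint \<open>price\<close>, which binds for \<open>star\<close>.\<close>

lemma maximal_eq_star:
  assumes max: "maximal s" and star: "feasible star"
  shows "s = star"
proof (rule maximal_eqI[OF max star])
  have s: "feasible s" using max by (rule maximal_feasible)
  fix p t
  assume in\<Theta>: "p \<in> \<Theta>" "t \<in> \<Theta>"
    and columns: "\<And>y x. \<lbrakk>y \<in> \<Theta>; y < p; x \<in> \<Theta>\<rbrakk> \<Longrightarrow> s (x, y) = star (x, y)"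
    and types: "\<And>x. \<lbrakk>x \<in> \<Theta>; x < t\<rbrakk> \<Longrightarrow> s (x, p) = star (x, p)"
  show "s (t, p) \<le> star (t, p)"
  proof (rule ccontr)
    assume gt: "\<not> ?thesis"
    obtain y where y: "p < y" "star (t, y) \<noteq> 0"
      using le_of_exhausted[OF s star in\<Theta>] columns in\<Theta>(2) gt by blast
    then have "y = price" "price \<noteq> base" "price \<le> t"
      using base(2)[OF in\<Theta>(1)] by (auto simp: star_eq split: if_splits)
    then have less: "p < price" "base < price" using y base(2)[OF price_in] by auto
    show False
    proof (cases "p = base")
      case True
      have "slack s base price < slack star base price"
        unfolding slack_def
      proof (intro sum_strict_mono_ex1 ballI bexI)
        fix x assume x: "x \<in> \<Theta>"
        show "(base - (if price \<le> x then price else 0)) * s (x, base)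
            \<le> (base - (if price \<le> x then price else 0)) * star (x, base)"
          using types[OF x] gt True less \<open>price \<le> t\<close> feasible_nonneg[OF s, of "(x, base)"]
          by (cases x t rule: linorder_cases)
            (auto simp: star_eq intro: mult_left_mono_neg mult_nonpos_nonneg)
      next
        show "(base - (if price \<le> t then price else 0)) * s (t, base)
            < (base - (if price \<le> t then price else 0)) * star (t, base)"
          using gt True less \<open>price \<le> t\<close> by (simp add: mult_strict_left_mono_neg)
      qed (use finite_types in\<Theta> in auto)
      then show False
        using star_slack_zero[OF star base(1)] slack_nonneg[OF s base(1) price_in] by simp
    next
      case False
      \<comment> \<open>Between \<open>base\<close> and \<open>price\<close>, \<open>star\<close>
        has already spent type \<open>p\<close> in the lowest segment, so the segment
        \<open>p\<close> of \<open>s\<close> lacks its own type and is empty.\<close>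
      have "s (p, p) \<le> star (p, p)"
        using in\<Theta>(1) columns less base(2)[OF in\<Theta>(1)]
        by (intro le_of_exhausted[OF s star]) (auto simp: star_eq)
      also have "star (p, p) = 0" using False less by (simp add: star_eq)
      finally have "s (t, p) = 0" using column_zero[OF s] feasible_nonneg[OF s] by (metis order_antisym)
      then show False using gt feasible_nonneg[OF star] by simp
    qed
  qed
qed

lemma maximal_without_rent:
  assumes max: "maximal s" and no_rent: "\<And>p. p \<in> \<Theta> \<Longrightarrow> slack s p price = 0"
  shows "s = star"
proof -
  have s: "feasible s" using max by (rule maximal_feasible)
  \<comment> \<open>In a nonempty segment priced above \<open>price\<close>, all buyers pay more
    than \<open>price\<close>, so the slack would be positive.\<close>
  have high: "s (p, p) = 0" if p: "p \<in> \<Theta>" "price < p" for p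
  proof (rule ccontr)
    assume "s (p, p) \<noteq> 0"
    then have "0 < s (p, p)" using feasible_nonneg[OF s] by (metis order_le_less)
    then have "0 < (p - price) * s (p, p)" using p by simp
    then have "0 < slack s p price"
      unfolding slack_def
      using p finite_types feasible_nonneg[OF s] types_pos[OF p(1)]
      by (intro sum_pos2[of _ p]) auto
    then show False using no_rent[OF p(1)] by simp
  qed
  have zero: "s (p, p) = 0" if p: "p \<in> \<Theta>" "p \<noteq> base" "p \<noteq> price" for p
  proof (rule ccontr)
    assume pp: "s (p, p) \<noteq> 0"
    have "base < p" using base(2)[OF p(1)] p(2) by simp
    have "p < price" using high[OF p(1)] pp p(3) by (metis linorder_neqE)
    \<comment> \<open>The lowest segment contains the whole lowest type, so its constraint
      \<open>price\<close> can bind only if somebody there would pay \<open>price\<close>. Such a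
      buyer lies above \<open>p\<close>, against \<open>maximal_monotone\<close>.\<close>
    have "\<exists>x\<in>\<Theta>. price \<le> x \<and> 0 < s (x, base)"
    proof (rule ccontr)
      assume none: "\<not> ?thesis"
      have "s (base, y) = 0" if "y \<in> \<Theta> - {base}" for y
        using that base(2)[of y] feasible_above[OF s, of base y] by simp
      then have "(\<Sum>y\<in>\<Theta>. s (base, y)) = s (base, base)"
        using finite_types base(1) by (simp add: sum.remove)
      then have "0 < s (base, base)"
        using feasible_marginal[OF s base(1)] pmf_type_pos[OF base(1)] by simp
      have "s (x, base) = 0" if "x \<in> \<Theta>" "price \<le> x" for x
        using none that feasible_nonneg[OF s] by (metis order_le_less)
      then have "slack s base price = (\<Sum>x\<in>\<Theta>. base * s (x, base))"
        unfolding slack_def by (intro sum.cong) auto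
      also have "\<dots> > 0"
        using \<open>0 < s (base, base)\<close> base(1) types_pos[OF base(1)] finite_types feasible_nonneg[OF s]
        by (intro sum_pos2[of _ base]) auto
      finally show False using no_rent[OF base(1)] by simp
    qed
    then obtain x where "price \<le> x" "0 < s (x, base)" by blast
    moreover have "0 < s (p, p)" using pp feasible_nonneg[OF s] by (metis order_le_less)
    ultimately show False
      using maximal_monotone[OF max base(1) \<open>base < p\<close>, of x] \<open>p < price\<close> by simp
  qed
  have two: "s (t, base) + s (t, price) = pmf \<mu> t" if "base \<noteq> price" "t \<in> \<Theta>" for t
    by (rule feasible_two_columns(1)[OF s]) (use zero that in auto)
  have one: "s (t, base) = pmf \<mu> t" if "base = price" "t \<in> \<Theta>" for t
    by (rule feasible_two_columns(2)[OF s]) (use zero that in auto)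
  have other: "s (t, p) = 0" if "p \<in> \<Theta>" "p \<noteq> base" "p \<noteq> price" for t p
    by (rule column_zero[OF s zero[OF that]])
  have "s (t, p) = star (t, p)" if in\<Theta>: "p \<in> \<Theta>" "t \<in> \<Theta>" for t p
  proof (cases "price = base")
    case True
    then show ?thesis
      using one[OF _ in\<Theta>(2)] other[OF in\<Theta>(1), of t] by (simp add: star_eq)
  next
    case False
    then have less: "base < price" using base(2)[OF price_in] by simp
    have "0 < s (price, price)" by (rule price_diagonal_pos[OF s zero less])
    then have above: "s (x, base) = 0" if "price < x" for x
      using maximal_monotone[OF max base(1) less] that by simp
    have below: "s (x, base) = pmf \<mu> x" if "x \<in> \<Theta>" "x < price" for x
      using two[OF _ that(1)] feasible_above[OF s that(2)] less by simp
    have "base * (\<Sum>t | t \<in> \<Theta> \<and> t < price. pmf \<mu> t) = (price - base) * s (price, base)"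
      using base_column_slack[of s, OF below above] no_rent[OF base(1)] by simp
    then have "s (price, base) = base / (price - base) * (\<Sum>t | t \<in> \<Theta> \<and> t < price. pmf \<mu> t)"
      using less by (simp add: field_simps)
    \<comment> \<open>The value forced by the binding constraint is at most the mass of type
      \<open>price\<close>, hence it is the minimum.\<close>
    then have share: "s (price, base) = base_share"
      using feasible_le_marginal[OF s, of price base] by (simp add: base_share_def)
    have "s (t, base) + s (t, price) = pmf \<mu> t" using two[OF _ in\<Theta>(2)] less by simp
    then show ?thesis
      using share above[of t] below[OF in\<Theta>(2)] other[OF in\<Theta>(1), of t] False
      by (cases t price rule: linorder_cases) (auto simp: star_eq feasible_above[OF s])
  qed
  moreover have "s (t, p) = star (t, p)" if "p \<notin> \<Theta> \<or> t \<notin> \<Theta>" for t p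
  proof -
    have "s (t, p) = 0" using that feasible_outside[OF s] by (auto simp: trade_region_def)
    moreover have "pmf \<mu> t = 0" if "t \<notin> \<Theta>" using that full_support by (metis set_pmf_iff)
    moreover have "p \<noteq> base" "p \<noteq> price" if "p \<notin> \<Theta>" using that base(1) price_in by auto
    ultimately show ?thesis using that price_in by (auto simp: star_eq)
  qed
  ultimately show ?thesis by (metis ext surj_pair)
qed

end

theorem proposition3:
  fixes \<Theta> :: "real set" and \<mu> :: "real pmf" and w :: "real \<Rightarrow> real \<Rightarrow> real"
  assumes "finite \<Theta>" and "\<Theta> \<noteq> {}" and "\<forall>t\<in>\<Theta>. 0 < t"
    and "set_pmf \<mu> = \<Theta>"
    and "strongly_redistributive \<Theta> w"
  shows "(obedient \<Theta> (sigma_star \<Theta> \<mu>) \<longrightarrow>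
            (\<forall>\<sigma>. optimal \<Theta> w \<mu> \<sigma> \<longleftrightarrow> \<sigma> = sigma_star \<Theta> \<mu>) \<and>
            \<not> gives_rent \<Theta> \<mu> (sigma_star \<Theta> \<mu>)) \<and>
         (\<not> obedient \<Theta> (sigma_star \<Theta> \<mu>) \<longrightarrow>
            (\<exists>!\<sigma>. optimal \<Theta> w \<mu> \<sigma>) \<and>
            (\<forall>\<sigma>. optimal \<Theta> w \<mu> \<sigma> \<longrightarrow> gives_rent \<Theta> \<mu> \<sigma>))"
proof -
  interpret redistributive_market \<Theta> \<mu> w
    using assms by unfold_locales auto
  obtain s where s: "maximal s" using maximal_exists by blast
  then obtain \<tau> where \<tau>: "pmf \<tau> = s" using feasible_imp_pmf maximal_feasible by blast
  have opt: "optimal \<Theta> w \<mu> \<sigma> \<longleftrightarrow> \<sigma> = \<tau>" for \<sigma>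
    unfolding optimal_iff using s \<tau> maximal_unique by (metis pmf_eqI)
  show ?thesis
  proof (intro conjI impI)
    assume "obedient \<Theta> (sigma_star \<Theta> \<mu>)"
    then have star: "feasible (pmf (sigma_star \<Theta> \<mu>))"
      by (simp add: obedient_star_iff pmf_star)
    then have "\<tau> = sigma_star \<Theta> \<mu>"
      using maximal_eq_star[OF s] \<tau> by (simp add: pmf_star pmf_eqI)
    then show "\<forall>\<sigma>. optimal \<Theta> w \<mu> \<sigma> \<longleftrightarrow> \<sigma> = sigma_star \<Theta> \<mu>" using opt by simp
    show "\<not> gives_rent \<Theta> \<mu> (sigma_star \<Theta> \<mu>)"
      using gives_rent_iff[OF star] star star_slack_zero by (simp add: pmf_star)
  next
    assume not: "\<not> obedient \<Theta> (sigma_star \<Theta> \<mu>)"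
    show "\<exists>!\<sigma>. optimal \<Theta> w \<mu> \<sigma>" unfolding opt by (rule ex1_eq)
    have "gives_rent \<Theta> \<mu> \<tau>"
    proof (rule ccontr)
      assume no_rent: "\<not> ?thesis"
      have feas: "feasible s" using s by (rule maximal_feasible)
      then have "(\<Sum>p\<in>\<Theta>. slack s p (uniform_price \<Theta> \<mu>)) \<le> 0"
        using gives_rent_iff[of \<tau>] \<tau> no_rent by simp
      then have "\<forall>p\<in>\<Theta>. slack s p (uniform_price \<Theta> \<mu>) = 0"
        using sum_nonneg_eq_0_iff[OF finite_types, of "\<lambda>p. slack s p (uniform_price \<Theta> \<mu>)"]
          slack_nonneg[OF feas _ price_in] sum_nonneg[of \<Theta> "\<lambda>p. slack s p (uniform_price \<Theta> \<mu>)"]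
        by (metis order_antisym)
      then have "s = sigma_star_density \<Theta> \<mu>" using maximal_without_rent[OF s] by blast
      then show False using not feas obedient_star_iff by simp
    qed
    then show "\<forall>\<sigma>. optimal \<Theta> w \<mu> \<sigma> \<longrightarrow> gives_rent \<Theta> \<mu> \<sigma>" using opt by simp
  qed
qed

end
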